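(* Let $m,n\geq 1$ be integers. Then $$\sum_{0\le r_1,\ldots,r_{3m}\leq n}\ \prod_{k=1}^{3m}{n-r_k\brack r_{k+1}}q^{\binom{r_k}{2}}(-1)^{r_k}=(-1)^{mn}(n+1)q^{m\binom{n}{2}},$$ where the sum is over integers $r_1,\ldots,r_{3m}$ and $r_{3m+1}=r_1$.
   Context: Here $q$ is an indeterminate. The $q$-binomial coefficient is defined for integers $n,k$ by ${n\brack k}=\prod_{i=1}^{k}\frac{1-q^{n-i+1}}{1-q^i}$ if $0\leq k\leq n$, and ${n\brack k}=0$ otherwise. Also $\binom{r}{2}=r(r-1)/2$. *)

theory Defs
  imports
    "HOL-Computational_Algebra.Fraction_Field"
    "HOL-Computational_Algebra.Polynomial"
    "HOL-Library.FuncSet"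
begin

text \<open>
  The indeterminate \<open>q\<close> is the generator of the field \<open>\<rat>(q)\<close> of rational functions,
  realised as the fraction field of \<open>\<rat>[q]\<close>.
\<close>

definition q :: "rat poly fract"
  where "q = Fraction_Field.Fract [:0, 1:] 1"

definition qbinom :: "int \<Rightarrow> int \<Rightarrow> rat poly fract"
  where "qbinom n k =
    (if 0 \<le> k \<and> k \<le> n then \<Prod>i=1..k. (1 - q powi (n - i + 1)) / (1 - q powi i) else 0)"

end

theory Submission
  imports Defs
begin

text \<open>
  The left-hand side is the trace of the \<open>3m\<close>-th power of the matrix
  \<open>M i j = [n - i, j] (-1)^i q^(i choose 2)\<close>, \<open>0 \<le> i, j \<le> n\<close>, and \<open>M^3\<close> is the scalar matrix
  \<open>(-1)^n q^(n choose 2)\<close>. Both the evaluation of \<open>M^2\<close> and that of \<open>M^3\<close> come down to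
  \<open>\<Sum>j. (-1)^j q^(j choose 2) [N, j] [n - j, k] = q^(N (n - k)) [n - N, n - k]\<close>,
  which follows by induction on \<open>N\<close> from the two \<open>q\<close>-Pascal rules.
\<close>

section \<open>Powers of \<open>q\<close>, q-factorials and q-binomial coefficients\<close>

lemma q_power: "q ^ k = Fraction_Field.Fract (monom 1 k) 1"
  by (induction k) (simp_all add: q_def One_fract_def monom_0 monom_Suc one_pCons)

text \<open>A monomial of positive degree is not constant; hence no denominator
  \<open>1 - q ^ i\<close> with \<open>i > 0\<close> vanishes.\<close>

lemma q_power_neq_1:
  assumes "k > 0"
  shows "q ^ k \<noteq> 1"
proof
  assume "q ^ k = 1"
  then have "monom 1 k = (1 :: rat poly)"
    by (simp add: q_power One_fract_def eq_fract)
  then have "degree (monom (1::rat) k) = 0"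
    by simp
  with assms show False
    by (simp add: degree_monom_eq)
qed

text \<open>The q-Pochhammer symbol (q; q)_n: the usual q-factorial times
  \<open>(1 - q) ^ n\<close>, a factor that cancels in q-binomial quotients.\<close>

definition qfact :: "nat \<Rightarrow> rat poly fract"
  where "qfact n = (\<Prod>i=1..n. 1 - q ^ i)"

lemma qfact_0 [simp]: "qfact 0 = 1"
  by (simp add: qfact_def)

lemma qfact_Suc: "qfact (Suc n) = (1 - q ^ Suc n) * qfact n"
  by (simp add: qfact_def prod.atLeast_Suc_atMost_Suc_shift atLeastAtMostSuc_conv mult.commute)

lemma qfact_neq_0 [simp]: "qfact n \<noteq> 0"
  using q_power_neq_1 by (fastforce simp: qfact_def)

lemma qfact_add: "(\<Prod>i=1..b. 1 - q ^ (a + i)) * qfact a = qfact (a + b)"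
  by (induction b) (simp_all add: qfact_Suc atLeastAtMostSuc_conv mult_ac)

definition qbin :: "nat \<Rightarrow> nat \<Rightarrow> rat poly fract"
  where "qbin n k = qbinom (int n) (int k)"

lemma qbin_eq_0: "n < k \<Longrightarrow> qbin n k = 0"
  by (simp add: qbin_def qbinom_def)

lemma qbin_add: "qbin (a + b) b = qfact (a + b) / (qfact a * qfact b)"
proof -
  have "qbin (a + b) b =
      (\<Prod>i=1..int b. (1 - q powi (int (a + b) - i + 1)) / (1 - q powi i))"
    by (simp add: qbin_def qbinom_def)
  also have "\<dots> = (\<Prod>i=1..b. (1 - q ^ (a + (b + 1 - i))) / (1 - q ^ i))"
  proof (rule prod.reindex_bij_witness[of _ int nat], goal_cases)
    case (5 i)
    then have "int (a + b) - i + 1 = int (a + (b + 1 - nat i))" and "i = int (nat i)"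
      by auto
    then show ?case
      by (metis power_int_of_nat)
  qed auto
  also have "\<dots> = (\<Prod>i=1..b. 1 - q ^ (a + (b + 1 - i))) / qfact b"
    by (simp add: prod_dividef qfact_def)
  also have "(\<Prod>i=1..b. 1 - q ^ (a + (b + 1 - i))) = (\<Prod>i=1..b. 1 - q ^ (a + i))"
    by (rule prod.reindex_bij_witness[of _ "\<lambda>i. b + 1 - i" "\<lambda>i. b + 1 - i"]) auto
  also have "\<dots> = qfact (a + b) / qfact a"
    by (metis qfact_add qfact_neq_0 nonzero_mult_div_cancel_right)
  finally show ?thesis
    by simp
qed

lemma qbin_0 [simp]: "qbin n 0 = 1"
  using qbin_add[of n 0] by simp

lemma qbin_symmetric: "k \<le> n \<Longrightarrow> qbin n (n - k) = qbin n k"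
  using qbin_add[of "n - k" k] qbin_add[of k "n - k"] by (simp add: mult.commute)

lemma qbin_self [simp]: "qbin n n = 1"
  using qbin_symmetric[of 0 n] by simp

lemma qbin_Suc_Suc: "qbin (Suc n) (Suc k) = qbin n k + q ^ Suc k * qbin n (Suc k)"
proof (cases "k < n")
  case True
  then obtain a where n: "n = a + Suc k"
    by (metis add.commute less_imp_Suc_add add_Suc_right)
  \<comment> \<open>Over the common denominator this is
    \<open>1 - x * y = (1 - y) + y * (1 - x)\<close>, to be used with \<open>x = q ^ Suc a\<close>
    and \<open>y = q ^ Suc k\<close>.\<close>
  have "(1 - x * y) * N / ((1 - x) * A * ((1 - y) * K)) =
      N / ((1 - x) * A * K) + y * (N / (A * ((1 - y) * K)))"
    if "x \<noteq> 1" "y \<noteq> 1" "A \<noteq> 0" "K \<noteq> 0" for x y N A K :: "rat poly fract"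
    using that by (simp add: divide_simps) (simp add: algebra_simps)
  moreover have "q ^ Suc a \<noteq> 1" "q ^ Suc k \<noteq> 1"
    by (rule q_power_neq_1; simp)+
  moreover have "qbin (Suc n) (Suc k)
      = (1 - q ^ Suc a * q ^ Suc k) * qfact n / ((1 - q ^ Suc a) * qfact a * ((1 - q ^ Suc k) * qfact k))"
    using qbin_add[of "Suc a" "Suc k"] by (simp add: n qfact_Suc power_add mult_ac)
  moreover have "qbin n k = qfact n / ((1 - q ^ Suc a) * qfact a * qfact k)"
    using qbin_add[of "Suc a" k] by (simp add: n qfact_Suc)
  moreover have "qbin n (Suc k) = qfact n / (qfact a * ((1 - q ^ Suc k) * qfact k))"
    using qbin_add[of a "Suc k"] by (simp add: n qfact_Suc)
  ultimately show ?thesis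
    by (simp only: qfact_neq_0 not_False_eq_True)
next
  case False
  then show ?thesis
    by (cases "k = n") (auto simp: qbin_eq_0)
qed

text \<open>The mirror image of \<open>qbin_Suc_Suc\<close> under the symmetry of q-binomials;
  \<open>d\<close> below is \<open>n - k - 1\<close>.\<close>

lemma qbin_Suc_Suc':
  assumes "k \<le> n"
  shows "qbin (Suc n) (Suc k) = qbin n (Suc k) + q ^ (n - k) * qbin n k"
proof (cases "k = n")
  case False
  then obtain d where n: "n = Suc (k + d)"
    using assms less_imp_Suc_add by (metis le_neq_implies_less)
  have "qbin (Suc n) (Suc k) = qbin (Suc n) (Suc d)"
    using qbin_symmetric[of "Suc k" "Suc n"] by (simp add: n)
  also have "\<dots> = qbin n d + q ^ Suc d * qbin n (Suc d)"
    by (rule qbin_Suc_Suc)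
  also have "qbin n d = qbin n (Suc k)"
    using qbin_symmetric[of "Suc k" n] by (simp add: n)
  also have "qbin n (Suc d) = qbin n k"
    using qbin_symmetric[of k n] by (simp add: n Suc_diff_le)
  finally show ?thesis
    by (simp add: n Suc_diff_le)
qed (simp add: qbin_eq_0)

section \<open>Alternating q-binomial convolutions\<close>

lemma choose_2_add: "(a + b choose 2) = (a choose 2) + (b choose 2) + a * b"
  by (induction b) (auto simp: numeral_2_eq_2 algebra_simps)

definition qbin_conv :: "nat \<Rightarrow> nat \<Rightarrow> nat \<Rightarrow> rat poly fract"
  where "qbin_conv N n k =
    (\<Sum>j\<le>N. (-1) ^ j * q ^ (j choose 2) * qbin N j * qbin (n - j) k)"

text \<open>By the q-binomial theorem the coefficients in \<open>qbin_conv\<close> are those of the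
  product of \<open>1 - q ^ i * E\<close> over \<open>i < N\<close>, with \<open>E\<close> read as
  lowering \<open>n\<close> by one. The recurrence splits off the next factor,
  \<open>i = N\<close>.\<close>

lemma qbin_conv_Suc:
  "qbin_conv (Suc N) (Suc n) k = qbin_conv N (Suc n) k - q ^ N * qbin_conv N n k"
proof -
  let ?s = "\<lambda>j. (-1) ^ j * q ^ (j choose 2)"
  have s: "?s (Suc j) * q ^ (N - j) = - (q ^ N * ?s j)" if "j \<le> N" for j
  proof -
    have "q ^ (Suc j choose 2) * q ^ (N - j) = q ^ ((j choose 2) + N)"
      using choose_2_add[of j 1] that by (simp add: binomial_eq_0 flip: power_add)
    then show ?thesis
      by (simp add: power_add mult.commute mult.assoc)
  qed
  \<comment> \<open>The added term \<open>j = Suc N\<close> is zero; it lets both convolutions be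
    split at \<open>j = 0\<close> into sums over the same range, ready for the second Pascal
    rule.\<close>
  have "qbin_conv N (Suc n) k = (\<Sum>j\<le>Suc N. ?s j * qbin N j * qbin (Suc n - j) k)"
    by (simp add: qbin_conv_def qbin_eq_0)
  also have "\<dots> = qbin (Suc n) k + (\<Sum>j\<le>N. ?s (Suc j) * qbin N (Suc j) * qbin (n - j) k)"
    by (subst sum.atMost_Suc_shift) (simp add: binomial_eq_0)
  finally have 1: "qbin_conv N (Suc n) k =
      qbin (Suc n) k + (\<Sum>j\<le>N. ?s (Suc j) * qbin N (Suc j) * qbin (n - j) k)" .
  have "qbin_conv (Suc N) (Suc n) k =
      qbin (Suc n) k + (\<Sum>j\<le>N. ?s (Suc j) * qbin (Suc N) (Suc j) * qbin (n - j) k)"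
    unfolding qbin_conv_def by (subst sum.atMost_Suc_shift) (simp add: binomial_eq_0)
  also have "(\<Sum>j\<le>N. ?s (Suc j) * qbin (Suc N) (Suc j) * qbin (n - j) k) =
      (\<Sum>j\<le>N. ?s (Suc j) * qbin N (Suc j) * qbin (n - j) k
        + (?s (Suc j) * q ^ (N - j)) * (qbin N j * qbin (n - j) k))"
    by (intro sum.cong refl) (simp add: qbin_Suc_Suc' ring_distribs mult_ac)
  also have "\<dots> = (\<Sum>j\<le>N. ?s (Suc j) * qbin N (Suc j) * qbin (n - j) k)
      + (\<Sum>j\<le>N. - (q ^ N * ?s j) * (qbin N j * qbin (n - j) k))"
    unfolding sum.distrib by (intro arg_cong2[of _ _ _ _ "(+)"] sum.cong refl) (simp only: s atMost_iff)
  also have "(\<Sum>j\<le>N. - (q ^ N * ?s j) * (qbin N j * qbin (n - j) k)) = - (q ^ N * qbin_conv N n k)"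
    by (simp add: qbin_conv_def sum_distrib_left sum_negf mult.assoc)
  finally show ?thesis
    using 1 by simp
qed

text \<open>The recurrence lowers \<open>n\<close> together with \<open>N\<close>, so
  \<open>n\<close> must vary in the induction. In the main case the first Pascal rule makes the two
  \<open>qbin (n - N) d\<close> terms cancel.\<close>

lemma qbin_conv_eq:
  assumes "N \<le> n" "k \<le> n"
  shows "qbin_conv N n k = q ^ (N * (n - k)) * qbin (n - N) (n - k)"
  using assms
proof (induction N arbitrary: n)
  case 0
  then show ?case
    by (simp add: qbin_conv_def qbin_symmetric binomial_eq_0)
next
  case (Suc N n')
  then obtain n where n': "n' = Suc n" and "N \<le> n"
    by (cases n') auto
  show ?case
  \<comment> \<open>For \<open>k = Suc n\<close> the induction hypothesis does not cover
    \<open>qbin_conv N n k\<close>, but there every upper argument is below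
    \<open>k\<close>.\<close>
  proof (cases "k = Suc n")
    case True
    have "qbin_conv N n k = 0"
      using True by (simp add: qbin_conv_def qbin_eq_0)
    with True show ?thesis
      using Suc.IH[of n'] Suc.prems by (simp add: n' qbin_conv_Suc)
  next
    case False
    then have "k \<le> n"
      using Suc.prems n' by simp
    define d where "d = n - k"
    have "qbin_conv (Suc N) n' k =
        q ^ (N * Suc d) * qbin (Suc (n - N)) (Suc d) - q ^ N * (q ^ (N * d) * qbin (n - N) d)"
      using Suc.IH[of n'] Suc.IH[of n] Suc.prems \<open>N \<le> n\<close> \<open>k \<le> n\<close>
      by (simp add: n' d_def qbin_conv_Suc Suc_diff_le)
    also have "\<dots> = q ^ (Suc N * Suc d) * qbin (n - N) (Suc d)"
      by (simp add: qbin_Suc_Suc power_add algebra_simps)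
    finally show ?thesis
      using \<open>k \<le> n\<close> \<open>N \<le> n\<close> by (simp add: n' d_def Suc_diff_le)
  qed
qed

section \<open>The matrix of the summand's factors, its square and its cube\<close>

definition qbin_mat :: "nat \<Rightarrow> nat \<Rightarrow> nat \<Rightarrow> rat poly fract"
  where "qbin_mat n i j = qbin (n - i) j * q ^ (i choose 2) * (-1) ^ i"

text \<open>Row \<open>i\<close> vanishes beyond column \<open>n - i\<close>, so the sum over
  \<open>j\<close> is a convolution with \<open>N = n - i\<close>.\<close>

lemma qbin_mat_square:
  assumes "i \<le> n" "k \<le> n"
  shows "(\<Sum>j\<le>n. qbin_mat n i j * qbin_mat n j k) =
    (-1) ^ i * q ^ ((i choose 2) + (n - i) * (n - k)) * qbin i (n - k)"
proof -
  have "(\<Sum>j\<le>n. qbin_mat n i j * qbin_mat n j k) = (\<Sum>j\<le>n - i. qbin_mat n i j * qbin_mat n j k)"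
    by (rule sum.mono_neutral_right) (auto simp: qbin_mat_def qbin_eq_0)
  also have "\<dots> = (-1) ^ i * q ^ (i choose 2) * qbin_conv (n - i) n k"
    by (simp add: qbin_mat_def qbin_conv_def sum_distrib_left mult_ac)
  finally show ?thesis
    using assms by (simp add: qbin_conv_eq power_add)
qed

text \<open>Reindexing turns the product of the square with the third factor into a scalar times
  \<open>qbin_conv i i l\<close>. For \<open>l \<le> i\<close> this is a power of \<open>q\<close>
  times \<open>qbin 0 (i - l)\<close>, for \<open>l > i\<close> all its terms vanish: a Kronecker
  delta.\<close>

lemma qbin_mat_cube:
  assumes "i \<le> n" "l \<le> n"
  shows "(\<Sum>k\<le>n. (\<Sum>j\<le>n. qbin_mat n i j * qbin_mat n j k) * qbin_mat n k l) =
    (if i = l then (-1) ^ n * q ^ (n choose 2) else 0)"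
proof -
  let ?c = "(-1) ^ n * q ^ (n choose 2)"
  have "(\<Sum>k\<le>n. (\<Sum>j\<le>n. qbin_mat n i j * qbin_mat n j k) * qbin_mat n k l) =
      (\<Sum>k\<le>n. (-1) ^ i * q ^ ((i choose 2) + (n - i) * (n - k)) * qbin i (n - k) * qbin_mat n k l)"
    using assms by (simp add: qbin_mat_square)
  also have "\<dots> = (\<Sum>k\<in>{n - i..n}.
      (-1) ^ i * q ^ ((i choose 2) + (n - i) * (n - k)) * qbin i (n - k) * qbin_mat n k l)"
    by (rule sum.mono_neutral_right) (auto simp: qbin_eq_0)
  also have "\<dots> = (\<Sum>b\<le>i. ?c * ((-1) ^ b * q ^ (b choose 2) * qbin i b * qbin (i - b) l))"
  proof (rule sum.reindex_bij_witness[of _ "\<lambda>b. b + (n - i)" "\<lambda>k. k - (n - i)"], goal_cases)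
    case (5 k)
    \<comment> \<open>In terms of \<open>a\<close>, \<open>b\<close>, \<open>c\<close> all truncated
      differences become sums, and \<open>choose_2_add\<close> reduces the exponent identity to
      polynomial algebra.\<close>
    define a b c where "a = n - k" and "b = k - (n - i)" and "c = n - i"
    have eqs: "i = a + b" "n = a + b + c" "k = b + c"
      using 5 assms by (auto simp: a_def b_def c_def)
    have "(i choose 2) + (n - i) * (n - k) + (k choose 2) = (n choose 2) + (b choose 2)"
      by (simp add: eqs choose_2_add algebra_simps)
    then have p: "q ^ ((i choose 2) + (n - i) * (n - k)) * q ^ (k choose 2) =
        q ^ (n choose 2) * q ^ (b choose 2)"
      by (simp flip: power_add)
    have s: "(-1) ^ i * (-1) ^ k = ((-1) ^ n * (-1) ^ b :: rat poly fract)"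
      by (simp add: eqs power_add)
    have "qbin i (n - k) = qbin i b"
      using qbin_symmetric[of b i] by (simp add: eqs)
    then have "(-1) ^ i * q ^ ((i choose 2) + (n - i) * (n - k)) * qbin i (n - k) * qbin_mat n k l =
        ((-1) ^ i * (-1) ^ k) * (q ^ ((i choose 2) + (n - i) * (n - k)) * q ^ (k choose 2)) *
          (qbin i b * qbin (n - k) l)"
      by (simp add: qbin_mat_def mult_ac)
    also have "\<dots> = ?c * ((-1) ^ b * q ^ (b choose 2) * qbin i b * qbin (n - k) l)"
      unfolding p s by (simp only: mult_ac)
    also have "qbin (n - k) l = qbin (i - b) l"
      by (simp add: eqs)
    finally show ?case
      unfolding b_def by (rule sym)
  qed (use assms in auto)
  also have "\<dots> = ?c * qbin_conv i i l"
    by (simp add: qbin_conv_def sum_distrib_left)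
  also have "qbin_conv i i l = (if i = l then 1 else 0)"
  proof (cases "l \<le> i")
    case True
    then show ?thesis
      by (auto simp: qbin_conv_eq qbin_eq_0)
  qed (simp add: qbin_conv_def qbin_eq_0)
  finally show ?thesis
    by simp
qed

section \<open>Sums over paths as iterated matrix application\<close>

definition mat_apply :: "'i set \<Rightarrow> ('i \<Rightarrow> 'i \<Rightarrow> 'a::comm_semiring_1) \<Rightarrow> ('i \<Rightarrow> 'a) \<Rightarrow> 'i \<Rightarrow> 'a"
  where "mat_apply A M g = (\<lambda>i. \<Sum>j\<in>A. M i j * g j)"

text \<open>A tuple \<open>r\<close> is a path with \<open>p\<close> steps, weighted by
  \<open>M\<close> along its edges and by \<open>h\<close> at its two ends. Summing out the last
  vertex absorbs one edge into \<open>h\<close>, which is why \<open>h\<close> is arbitrary in the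
  induction.\<close>

lemma sum_paths:
  fixes M :: "'i \<Rightarrow> 'i \<Rightarrow> 'a::comm_semiring_1"
  shows "(\<Sum>r \<in> {1..Suc p} \<rightarrow>\<^sub>E A. (\<Prod>k=1..p. M (r k) (r (Suc k))) * h (r 1) (r (Suc p))) =
    (\<Sum>i\<in>A. (mat_apply A M ^^ p) (h i) i)"
proof (induction p arbitrary: h)
  case 0
  have "(\<Sum>r \<in> {Suc 0} \<rightarrow>\<^sub>E A. h (r (Suc 0)) (r (Suc 0))) = (\<Sum>i\<in>A. h i i)"
    by (rule sum.reindex_bij_witness[of _ "\<lambda>i. \<lambda>x\<in>{Suc 0}. i" "\<lambda>r. r (Suc 0)"])
      (auto simp: PiE_iff extensional_def)
  then show ?case
    by simp
next
  case (Suc p)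
  let ?D = "{1..Suc p}"
  have ins: "{1..Suc (Suc p)} = insert (Suc (Suc p)) ?D"
    by auto
  have inj: "inj_on (\<lambda>(y, r). r(Suc (Suc p) := y)) (A \<times> (?D \<rightarrow>\<^sub>E A))"
    by (rule inj_combinator) simp
  let ?F = "\<lambda>r. (\<Prod>k=1..Suc p. M (r k) (r (Suc k))) * h (r 1) (r (Suc (Suc p)))"
  \<comment> \<open>Only the last edge and the second argument of \<open>h\<close> see the new
    endpoint \<open>y\<close>.\<close>
  have F: "?F (r(Suc (Suc p) := y)) =
      (\<Prod>k=1..p. M (r k) (r (Suc k))) * (M (r (Suc p)) y * h (r 1) y)" for r y
  proof -
    have "(\<Prod>k=1..p. M ((r(Suc (Suc p) := y)) k) ((r(Suc (Suc p) := y)) (Suc k))) =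
        (\<Prod>k=1..p. M (r k) (r (Suc k)))"
      by (rule prod.cong) auto
    then show ?thesis
      by (simp add: atLeastAtMostSuc_conv mult_ac del: fun_upd_apply) (simp add: mult_ac)
  qed
  have "(\<Sum>r \<in> {1..Suc (Suc p)} \<rightarrow>\<^sub>E A. ?F r) =
      (\<Sum>(y, r) \<in> A \<times> (?D \<rightarrow>\<^sub>E A). ?F (r(Suc (Suc p) := y)))"
    unfolding ins PiE_insert_eq
    by (subst sum.reindex[OF inj]) (simp add: case_prod_unfold del: fun_upd_apply)
  also have "\<dots> = (\<Sum>r \<in> ?D \<rightarrow>\<^sub>E A. \<Sum>y\<in>A. ?F (r(Suc (Suc p) := y)))"
    by (simp only: flip: sum.cartesian_product) (rule sum.swap)
  also have "\<dots> = (\<Sum>r \<in> ?D \<rightarrow>\<^sub>E A. (\<Prod>k=1..p. M (r k) (r (Suc k))) *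
      mat_apply A M (h (r 1)) (r (Suc p)))"
    by (simp only: F mat_apply_def sum_distrib_left)
  also have "\<dots> = (\<Sum>i\<in>A. (mat_apply A M ^^ p) (mat_apply A M (h i)) i)"
    by (rule Suc.IH)
  finally show ?case
    by (simp add: funpow_swap1)
qed

text \<open>Both sides are the trace of the \<open>p\<close>-th power of \<open>M\<close>: each
  diagonal entry comes from applying the power to a unit vector, and the edge closing the cycle
  plays the part of \<open>h\<close> in \<open>sum_paths\<close>.\<close>

lemma sum_closed_paths:
  fixes M :: "'i \<Rightarrow> 'i \<Rightarrow> 'a::comm_semiring_1"
  assumes "finite A" "p \<ge> 1"
  shows "(\<Sum>r \<in> {1..p} \<rightarrow>\<^sub>E A. \<Prod>k=1..p. M (r k) (r (if k = p then 1 else k + 1))) =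
    (\<Sum>i\<in>A. (mat_apply A M ^^ p) (\<lambda>j. if j = i then 1 else 0) i)"
proof -
  obtain s where p: "p = Suc s"
    using assms by (cases p) auto
  have "(\<Prod>k=1..p. M (r k) (r (if k = p then 1 else k + 1))) =
      (\<Prod>k=1..s. M (r k) (r (Suc k))) * M (r (Suc s)) (r 1)" for r
  proof -
    have "(\<Prod>k=1..s. M (r k) (r (if k = p then 1 else k + 1))) =
        (\<Prod>k=1..s. M (r k) (r (Suc k)))"
      by (rule prod.cong) (auto simp: p)
    then show ?thesis
      by (simp add: p)
  qed
  then have "(\<Sum>r \<in> {1..p} \<rightarrow>\<^sub>E A. \<Prod>k=1..p. M (r k) (r (if k = p then 1 else k + 1))) =
      (\<Sum>i\<in>A. (mat_apply A M ^^ s) (\<lambda>j. M j i) i)"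
    using sum_paths[where p = s and h = "\<lambda>i j. M j i"] by (simp add: p)
  \<comment> \<open>Column \<open>i\<close> of \<open>M\<close> is \<open>M\<close> applied to the
    unit vector at \<open>i\<close>; this supplies the missing \<open>p\<close>-th
    application.\<close>
  also have "\<dots> = (\<Sum>i\<in>A. (mat_apply A M ^^ s) (mat_apply A M (\<lambda>j. if j = i then 1 else 0)) i)"
  proof (rule sum.cong)
    fix i assume "i \<in> A"
    then have "mat_apply A M (\<lambda>j. if j = i then 1 else 0) = (\<lambda>j. M j i)"
      using assms(1) by (simp add: mat_apply_def if_distrib[of "\<lambda>x. _ * x"] cong: if_cong)
    then show "(mat_apply A M ^^ s) (\<lambda>j. M j i) i =
        (mat_apply A M ^^ s) (mat_apply A M (\<lambda>j. if j = i then 1 else 0)) i"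
      by simp
  qed simp
  finally show ?thesis
    by (simp add: p funpow_swap1)
qed

section \<open>The trace of the \<open>3 * m\<close>-th power\<close>

lemma mat_apply_qbin_mat_cube:
  assumes "i \<le> n"
  shows "(mat_apply {..n} (qbin_mat n) ^^ 3) g i = (-1) ^ n * q ^ (n choose 2) * g i"
proof -
  let ?K = "qbin_mat n"
  have "(mat_apply {..n} ?K ^^ 3) g i =
      (\<Sum>j\<le>n. \<Sum>k\<le>n. \<Sum>l\<le>n. ?K i j * ?K j k * ?K k l * g l)"
    by (simp add: mat_apply_def eval_nat_numeral sum_distrib_left mult_ac)
  \<comment> \<open>Three interchanges move \<open>l\<close> outermost and \<open>j\<close>
    innermost, exposing the entries of the cube.\<close>
  also have "\<dots> = (\<Sum>k\<le>n. \<Sum>j\<le>n. \<Sum>l\<le>n. ?K i j * ?K j k * ?K k l * g l)"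
    by (rule sum.swap)
  also have "\<dots> = (\<Sum>k\<le>n. \<Sum>l\<le>n. \<Sum>j\<le>n. ?K i j * ?K j k * ?K k l * g l)"
    by (intro sum.cong refl sum.swap)
  also have "\<dots> = (\<Sum>l\<le>n. \<Sum>k\<le>n. \<Sum>j\<le>n. ?K i j * ?K j k * ?K k l * g l)"
    by (rule sum.swap)
  also have "\<dots> = (\<Sum>l\<le>n. (\<Sum>k\<le>n. (\<Sum>j\<le>n. ?K i j * ?K j k) * ?K k l) * g l)"
    by (simp add: sum_distrib_right)
  also have "\<dots> = (\<Sum>l\<le>n. if i = l then (-1) ^ n * q ^ (n choose 2) * g l else 0)"
    using assms by (intro sum.cong refl) (simp add: qbin_mat_cube)
  finally show ?thesis
    using assms by simp
qed

lemma mat_apply_qbin_mat_pow: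
  assumes "i \<le> n"
  shows "(mat_apply {..n} (qbin_mat n) ^^ (3 * m)) g i = ((-1) ^ n * q ^ (n choose 2)) ^ m * g i"
proof (induction m)
  case (Suc m)
  have "(mat_apply {..n} (qbin_mat n) ^^ (3 * Suc m)) g =
      (mat_apply {..n} (qbin_mat n) ^^ 3) ((mat_apply {..n} (qbin_mat n) ^^ (3 * m)) g)"
    by (simp only: mult_Suc_right funpow_add comp_def)
  with Suc assms show ?case
    by (simp add: mat_apply_qbin_mat_cube mult.assoc)
qed simp

theorem corollary2p3:
  fixes m n :: nat
  assumes "m \<ge> 1" and "n \<ge> 1"
  shows "(\<Sum>r \<in> {1..3*m} \<rightarrow>\<^sub>E {0..n}.
            \<Prod>k=1..3*m.
              qbinom (int n - int (r k)) (int (r (if k = 3*m then 1 else k + 1)))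
                * q ^ (r k choose 2) * (-1) ^ r k)
         = (-1) ^ (m * n) * of_nat (n + 1) * q ^ (m * (n choose 2))"
proof -
  have "(\<Sum>r \<in> {1..3*m} \<rightarrow>\<^sub>E {0..n}.
            \<Prod>k=1..3*m.
              qbinom (int n - int (r k)) (int (r (if k = 3*m then 1 else k + 1)))
                * q ^ (r k choose 2) * (-1) ^ r k) =
      (\<Sum>r \<in> {1..3*m} \<rightarrow>\<^sub>E {..n}. \<Prod>k=1..3*m. qbin_mat n (r k) (r (if k = 3*m then 1 else k + 1)))"
    unfolding atLeast0AtMost
  proof (intro sum.cong prod.cong refl)
    fix r k assume "r \<in> {1..3*m} \<rightarrow>\<^sub>E {..n}" "k \<in> {1..3*m}"
    \<comment> \<open>This bound makes the integer difference agree with the natural one in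
      \<open>qbin_mat\<close>.\<close>
    then have "r k \<le> n"
      using PiE_mem by fastforce
    then show "qbinom (int n - int (r k)) (int (r (if k = 3*m then 1 else k + 1)))
        * q ^ (r k choose 2) * (-1) ^ r k = qbin_mat n (r k) (r (if k = 3*m then 1 else k + 1))"
      by (simp only: qbin_mat_def qbin_def of_nat_diff)
  qed
  \<comment> \<open>The power is a scalar matrix, so its \<open>n + 1\<close> diagonal entries are
    equal; \<open>m \<ge> 1\<close> ensures that the cycle has positive length.\<close>
  also have "\<dots> = (\<Sum>i\<le>n. ((-1) ^ n * q ^ (n choose 2)) ^ m)"
    using assms by (subst sum_closed_paths) (simp_all add: mat_apply_qbin_mat_pow)
  also have "\<dots> = (-1) ^ (m * n) * of_nat (n + 1) * q ^ (m * (n choose 2))"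
    by (simp add: power_mult_distrib mult_ac flip: power_mult)
  finally show ?thesis .
qed

end
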